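(* Let $F$ be a field, complete with respect to a non-Archimedean norm $|\cdot|_F$, and let $(\mathcal{U},\mathbf{eval})$ be an umbral calculus on $F[[T]]$. Let $\mathcal{F}:F\to\mathcal{U}$ be an umbral map, and let $x\in\mathcal{A}_{\mathcal{F}}$. Then for every bounded power series $P(T)=\sum_{k=0}^{\infty}a_kT^k\in F_b[[T]]$, $$\mathcal{D}_{\mathcal{F}}(x)P(T)=\mathbf{eval}\big(P(T+\mathcal{F}(x))\big)=\sum_{k=0}^{\infty}a_k\Big(\sum_{m=0}^{k}\binom{k}{m}\mathcal{F}_m(x)T^{k-m}\Big).$$
   Context: The characteristic of $F$ is arbitrary. An umbral calculus on $F[[T]]$ is a pair $(\mathcal{U},\mathbf{eval})$ where $\mathcal{U}$ is a set of indeterminates called umbrae and $\mathbf{eval}:F[[T]][\mathcal{U}]\to F[[T]]$ is a linear map (linear over $F[[T]]$) such that $\mathbf{eval}(1)=1$, $\mathbf{eval}(\alpha^n)\in F$ for every umbra $\alpha$ and $n\ge0$, and $\mathbf{eval}(\alpha_1^{n_1}\cdots\alpha_m^{n_m})=\mathbf{eval}(\alpha_1^{n_1})\cdots\mathbf{eval}(\alpha_m^{n_m})$ for distinct umbrae $\alpha_1,\dots,\alpha_m$. For a finite set $\mathcal{S}=\{\gamma_1,\dots,\gamma_s\}$ of distinct umbrae, an element $P=\sum_{n\ge0}U_nT^n$ of $F[[T]][[\mathcal{S}]]$ (with $U_n\in F[[\mathcal{S}]]$) is admissible if for each $n$, writing $U_n=\sum a_{m_1,\dots,m_s}\gamma_1^{m_1}\cdots\gamma_s^{m_s}$,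 the series $\mathbf{eval}(U_n):=\sum a_{m_1,\dots,m_s}\mathbf{eval}(\gamma_1^{m_1})\cdots\mathbf{eval}(\gamma_s^{m_s})$ converges in $F$; then $\mathbf{eval}(P):=\sum_n\mathbf{eval}(U_n)T^n$. A power series $\sum a_mT^m\in F[[T]]$ is bounded if there is $c>0$ with $|a_m|_F<c$ for all $m$; $F_b[[T]]$ denotes the algebra of bounded power series. The $k$-th Hasse derivative $\mathbf{D}^{(k)}$ is the $F$-linear operator on $F[[T]]$ with $\mathbf{D}^{(k)}T^n=\binom{n}{k}T^{n-k}$ if $n\ge k$ and $0$ otherwise. An umbral map is a map $\mathcal{F}:F\to\mathcal{U}$; for $x\in F$ write $\mathcal{F}_k(x)=\mathbf{eval}(\mathcal{F}(x)^k)$. Set $\mathcal{A}_{\mathcal{F}}=\{x\in F:\mathcal{F}_k(x)\to0 \text{ as } k\to\infty\}$. For $x\in\mathcal{A}_{\mathcal{F}}$ the flow $\mathcal{D}_{\mathcal{F}}(x):F_b[[T]]\to F[[T]]$ is $\mathcal{D}_{\mathcal{F}}(x)=\sum_{k\ge0}\mathcal{F}_k(x)\mathbf{D}^{(k)}$. Here $P(T+\mathcal{F}(x))=\sum_k a_k(T+\mathcal{F}(x))^k\in F[[T]][[\mathcal{F}(x)]]$. *)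

theory Defs
  imports
    "HOL-Library.Poly_Mapping"
    "HOL-Computational_Algebra.Formal_Power_Series"
    "HOL-Analysis.Infinite_Sum"
begin

text \<open>
  The library's normed fields are real algebras, hence Archimedean of characteristic 0, so
  complete non-Archimedean fields get their own classes. The topology is the metric one, so that
  convergence is the library's.
\<close>

class nonarch_field = field + metric_space +
  fixes nonarch_norm :: "'a \<Rightarrow> real"
  assumes dist_nonarch_norm: "dist x y = nonarch_norm (x - y)"
    and nonarch_norm_eq_zero: "nonarch_norm x = 0 \<longleftrightarrow> x = 0"
    and nonarch_norm_mult: "nonarch_norm (x * y) = nonarch_norm x * nonarch_norm y"
    and nonarch_norm_add: "nonarch_norm (x + y) \<le> max (nonarch_norm x) (nonarch_norm y)"

class complete_nonarch_field = nonarch_field + complete_space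


text \<open>
  The umbrae are the elements of a type \<open>'u\<close>. Monomials in the umbrae are finitely supported
  exponent vectors, and \<open>('u, 'a) umbral_poly\<close> is the polynomial ring F[[T]][U]; scalars from
  F[[T]] sit in the coefficient of the monomial \<open>0\<close>.
\<close>

type_synonym ('u, 'a) umbral_poly = "('u \<Rightarrow>\<^sub>0 nat) \<Rightarrow>\<^sub>0 'a fps"

definition scalar :: "'a::field fps \<Rightarrow> ('u, 'a) umbral_poly" where
  "scalar c = Poly_Mapping.single 0 c"

definition umbra :: "'u \<Rightarrow> ('u, 'a::field) umbral_poly" where
  "umbra \<alpha> = Poly_Mapping.single (Poly_Mapping.single \<alpha> 1) 1"

locale umbral_calculus =
  module_hom "\<lambda>c p. scalar c * p" "(*)" eval
  for eval :: "('u, 'a::field) umbral_poly \<Rightarrow> 'a fps" +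
  assumes eval_one: "eval 1 = 1"
    and eval_power_in_field: "\<exists>c. eval (umbra \<alpha> ^ n) = fps_const c"
    and eval_monomial:
      "finite S \<Longrightarrow> eval (\<Prod>\<alpha>\<in>S. umbra \<alpha> ^ e \<alpha>) = (\<Prod>\<alpha>\<in>S. eval (umbra \<alpha> ^ e \<alpha>))"

text \<open>The value of \<open>eval (\<alpha> ^ n)\<close>, which is a constant power series, as an element of F.\<close>

definition moment :: "(('u, 'a::field) umbral_poly \<Rightarrow> 'a fps) \<Rightarrow> 'u \<Rightarrow> nat \<Rightarrow> 'a" where
  "moment eval \<alpha> n = fps_nth (eval (umbra \<alpha> ^ n)) 0"


text \<open>
  Elements of F[[T]][[S]] are given by their coefficients in F[[T]] at the monomials in S; the
  series \<open>U\<^sub>n\<close> in F[[S]] has the coefficients \<open>\<lambda>m. fps_nth (P m) n\<close>.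
\<close>

type_synonym ('u, 'a) umbral_series = "('u \<Rightarrow>\<^sub>0 nat) \<Rightarrow> 'a fps"

definition monomials :: "'u set \<Rightarrow> ('u \<Rightarrow>\<^sub>0 nat) set" where
  "monomials S = {m. Poly_Mapping.keys m \<subseteq> S}"

definition umbral_series_in :: "'u set \<Rightarrow> ('u, 'a::field) umbral_series set" where
  "umbral_series_in S = {P. \<forall>m. m \<notin> monomials S \<longrightarrow> P m = 0}"

definition eval_term ::
  "(('u, 'a::field) umbral_poly \<Rightarrow> 'a fps) \<Rightarrow> 'u set \<Rightarrow> ('u, 'a) umbral_series \<Rightarrow> nat
    \<Rightarrow> ('u \<Rightarrow>\<^sub>0 nat) \<Rightarrow> 'a" where
  "eval_term eval S P n m =
     fps_nth (P m) n * (\<Prod>\<gamma>\<in>S. moment eval \<gamma> (Poly_Mapping.lookup m \<gamma>))"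

definition admissible ::
  "(('u, 'a::nonarch_field) umbral_poly \<Rightarrow> 'a fps) \<Rightarrow> 'u set \<Rightarrow> ('u, 'a) umbral_series \<Rightarrow> bool"
  where
  "admissible eval S P \<longleftrightarrow>
     finite S \<and> P \<in> umbral_series_in S \<and> (\<forall>n. eval_term eval S P n summable_on monomials S)"

definition eval_series ::
  "(('u, 'a::nonarch_field) umbral_poly \<Rightarrow> 'a fps) \<Rightarrow> 'u set \<Rightarrow> ('u, 'a) umbral_series \<Rightarrow> 'a fps"
  where
  "eval_series eval S P = Abs_fps (\<lambda>n. infsum (eval_term eval S P n) (monomials S))"

text \<open>
  The formal sum of \<open>a\<^sub>k (T + \<gamma>)\<^sup>k\<close> in F[[T]][[\<open>\<gamma>\<close>]], collected coefficient by coefficient; at each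
  monomial in \<open>\<gamma>\<close> and T only one summand is nonzero, see \<open>umbral_shift_nth\<close>.
\<close>

definition umbral_shift :: "'a::field fps \<Rightarrow> 'u \<Rightarrow> ('u, 'a) umbral_series" where
  "umbral_shift P \<gamma> = (\<lambda>m. Abs_fps (\<lambda>n. Sum_any (\<lambda>k.
     fps_nth P k * fps_nth (Poly_Mapping.lookup ((scalar fps_X + umbra \<gamma>) ^ k) m) n)))"


definition bounded_fps :: "'a::nonarch_field fps set" where
  "bounded_fps = {P. \<exists>c>0. \<forall>m. nonarch_norm (fps_nth P m) < c}"

text \<open>
  Series in F[[T]] are summed coefficientwise with respect to the norm of F. (The metric on the
  type of formal power series is the T-adic one, for which the series below diverge in general.)
\<close>

definition coeffwise_summable :: "(nat \<Rightarrow> 'a::nonarch_field fps) \<Rightarrow> bool" where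
  "coeffwise_summable f \<longleftrightarrow> (\<forall>n. summable (\<lambda>k. fps_nth (f k) n))"

definition coeffwise_suminf :: "(nat \<Rightarrow> 'a::nonarch_field fps) \<Rightarrow> 'a fps" where
  "coeffwise_suminf f = Abs_fps (\<lambda>n. suminf (\<lambda>k. fps_nth (f k) n))"

text \<open>
  The Hasse derivative is determined on powers of T (see \<open>hasse_deriv_X_power\<close>) and extended to
  infinite sums in the evident way.
\<close>

definition hasse_deriv :: "nat \<Rightarrow> 'a::field fps \<Rightarrow> 'a fps" where
  "hasse_deriv k P = Abs_fps (\<lambda>n. of_nat ((n + k) choose k) * fps_nth P (n + k))"

text \<open>An umbral map \<open>\<F>\<close> has \<open>\<F>\<^sub>k(x) = moment eval (\<F> x) k\<close>; \<open>null_points eval \<F>\<close> is its set \<open>A\<^sub>\<F>\<close>.\<close>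

definition null_points ::
  "(('u, 'a::nonarch_field) umbral_poly \<Rightarrow> 'a fps) \<Rightarrow> ('a \<Rightarrow> 'u) \<Rightarrow> 'a set" where
  "null_points eval \<F> = {x. (\<lambda>k. moment eval (\<F> x) k) \<longlonglongrightarrow> 0}"

definition flow_term ::
  "(('u, 'a::nonarch_field) umbral_poly \<Rightarrow> 'a fps) \<Rightarrow> ('a \<Rightarrow> 'u) \<Rightarrow> 'a \<Rightarrow> 'a fps \<Rightarrow> nat \<Rightarrow> 'a fps"
  where
  "flow_term eval \<F> x P k = fps_const (moment eval (\<F> x) k) * hasse_deriv k P"

definition flow ::
  "(('u, 'a::nonarch_field) umbral_poly \<Rightarrow> 'a fps) \<Rightarrow> ('a \<Rightarrow> 'u) \<Rightarrow> 'a \<Rightarrow> 'a fps \<Rightarrow> 'a fps" where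
  "flow eval \<F> x P = coeffwise_suminf (flow_term eval \<F> x P)"


lemma hasse_deriv_X_power:
  "hasse_deriv k (fps_X ^ n :: 'a::field fps) =
     (if k \<le> n then of_nat (n choose k) * fps_X ^ (n - k) else 0)"
  by (rule fps_ext) (auto simp: hasse_deriv_def fps_X_power_nth simp flip: fps_of_nat)

lemma umbra_power: "umbra \<alpha> ^ m = Poly_Mapping.single (Poly_Mapping.single \<alpha> m) 1"
  by (induction m) (simp_all add: umbra_def mult_single single_add[symmetric] flip: single_one)

lemma scalar_X_power: "scalar fps_X ^ m = scalar (fps_X ^ m)"
  by (induction m) (simp_all add: scalar_def mult_single flip: single_one)

lemma lookup_shift_power:
  "Poly_Mapping.lookup ((scalar fps_X + umbra \<gamma> :: ('u, 'a::field) umbral_poly) ^ k) m =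
     (\<Sum>j\<le>k. if m = Poly_Mapping.single \<gamma> (k - j) then of_nat (k choose j) * fps_X ^ j else 0)"
proof -
  have *: "of_nat c * (Poly_Mapping.single 0 a * Poly_Mapping.single e 1 :: ('u, 'a) umbral_poly)
      = Poly_Mapping.single e (of_nat c * a)" for c e a
    by (induction c) (simp_all add: mult_single algebra_simps single_add)
  show ?thesis
    unfolding binomial_ring scalar_X_power umbra_power
    by (auto simp: scalar_def mult.assoc * lookup_sum lookup_single when_def intro!: sum.cong)
qed

lemma umbral_shift_nth:
  fixes P :: "'a::field fps"
  shows
  "fps_nth (umbral_shift P \<gamma> (Poly_Mapping.single \<gamma> m)) n =
     of_nat ((n + m) choose m) * fps_nth P (n + m)"
proof -
  have single_eq: "Poly_Mapping.single \<gamma> a = Poly_Mapping.single \<gamma> b \<longleftrightarrow> a = b" for a b :: nat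
    by (metis lookup_single_eq)
  define g where "g k = fps_nth P k *
    fps_nth (Poly_Mapping.lookup ((scalar fps_X + umbra \<gamma>) ^ k) (Poly_Mapping.single \<gamma> m)) n" for k
  have summand: "fps_nth (if m = k - j then of_nat (k choose j) * fps_X ^ j else 0 :: 'a fps) n =
      (if j = n then if m = k - n then of_nat (k choose n) else 0 else 0)" for k j
    by (auto simp: fps_X_power_nth simp flip: fps_of_nat)
  have g: "g k = (if k = n + m then of_nat ((n + m) choose m) * fps_nth P (n + m) else 0)" for k
    unfolding g_def lookup_shift_power single_eq fps_sum_nth summand
    using binomial_symmetric[of n "n + m"] by auto
  have "fps_nth (umbral_shift P \<gamma> (Poly_Mapping.single \<gamma> m)) n = Sum_any g"
    by (simp add: umbral_shift_def g_def[abs_def])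
  also have "\<dots> = (\<Sum>k\<in>{n + m}. g k)"
    by (rule Sum_any.expand_superset) (auto simp: g)
  finally show ?thesis by (simp add: g)
qed

lemma umbral_shift_in:
  fixes P :: "'a::field fps" and \<gamma> :: 'u
  shows "umbral_shift P \<gamma> \<in> umbral_series_in {\<gamma>}"
proof -
  have "Poly_Mapping.lookup ((scalar fps_X + umbra \<gamma> :: ('u, 'a) umbral_poly) ^ k) m = 0"
    if "m \<notin> monomials {\<gamma>}" for k m
  proof -
    have "m \<noteq> Poly_Mapping.single \<gamma> j" for j
      using that by (auto simp: monomials_def split: if_splits)
    then show ?thesis by (simp add: lookup_shift_power)
  qed
  then show ?thesis
    by (auto simp: umbral_series_in_def umbral_shift_def fps_eq_iff)
qed

end

theory Submission
  imports Defs
begin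

text \<open>
  The coefficient of \<open>T\<^sup>n\<close> in each of the three expressions is a rearrangement of one and the same
  series \<open>\<Sum>\<^sub>m binom(n+m, m) a\<^sub>n\<^sub>+\<^sub>m \<F>\<^sub>m(x)\<close>. Integers have norm at most 1 and \<open>a\<close> is bounded, so its
  terms tend to 0. By the ultrametric inequality and completeness it then converges
  unconditionally, so the order of summation is immaterial.
\<close>

lemma nonarch_norm_nonneg: "nonarch_norm (x::'a::nonarch_field) \<ge> 0"
  using zero_le_dist[of x 0] by (simp add: dist_nonarch_norm)

lemma nonarch_norm_zero [simp]: "nonarch_norm (0::'a::nonarch_field) = 0"
  by (simp add: nonarch_norm_eq_zero)

lemma nonarch_norm_one [simp]: "nonarch_norm (1::'a::nonarch_field) = 1"
  using nonarch_norm_mult[of "1::'a" 1] nonarch_norm_eq_zero[of "1::'a"] by simp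

text \<open>By the ultrametric inequality, repeatedly adding 1 never leaves the unit ball. Hence the
  binomial coefficients cannot spoil the decay of the moments.\<close>

lemma nonarch_norm_of_nat: "nonarch_norm (of_nat n :: 'a::nonarch_field) \<le> 1"
proof (induction n)
  case (Suc n)
  then show ?case
    using nonarch_norm_add[of "1::'a" "of_nat n"] by simp
qed simp

text \<open>The ultrametric inequality bounds a sum by its largest term, so nothing is lost with the
  number of terms. Positivity of \<open>e\<close> covers the empty sum, and also infinite
  \<open>A\<close>, where \<open>sum\<close> is 0 by default.\<close>

lemma nonarch_norm_sum_less:
  fixes f :: "'b \<Rightarrow> 'a::nonarch_field"
  assumes "e > 0" and "\<And>i. i \<in> A \<Longrightarrow> nonarch_norm (f i) < e"
  shows "nonarch_norm (sum f A) < e"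
  using assms(2)
proof (induction A rule: infinite_finite_induct)
  case (insert i A)
  then show ?case
    using nonarch_norm_add[of "f i" "sum f A"] by (simp add: le_max_iff_disj) fastforce
qed (use assms(1) in simp_all)

lemma tendsto_zero_nonarch_iff:
  fixes f :: "'b \<Rightarrow> 'a::nonarch_field"
  shows "(f \<longlongrightarrow> 0) F \<longleftrightarrow> ((\<lambda>k. nonarch_norm (f k)) \<longlongrightarrow> 0) F"
  by (simp add: tendsto_dist_iff[of f] dist_nonarch_norm)

text \<open>One estimate, uniform over all finite sets containing a long initial segment, serves
  twice: on initial segments it makes the partial sums Cauchy, and on arbitrary finite sets it makes
  their limit the unordered sum.\<close>

lemma has_sum_nonarch:
  fixes f :: "nat \<Rightarrow> 'a::complete_nonarch_field"
  assumes "f \<longlonglongrightarrow> 0"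
  obtains s where "(f has_sum s) UNIV"
proof -
  have tail: "\<exists>N. \<forall>X. finite X \<longrightarrow> {..<N} \<subseteq> X \<longrightarrow> dist (sum f X) (sum f {..<N}) < e"
    if "e > 0" for e
  proof -
    obtain N where N: "\<And>k. k \<ge> N \<Longrightarrow> nonarch_norm (f k) < e"
      using metric_LIMSEQ_D[OF assms \<open>e > 0\<close>] by (auto simp: dist_nonarch_norm)
    \<comment> \<open>The difference is the sum over \<open>X - {..<N}\<close>, all of whose indices
      are at least \<open>N\<close>.\<close>
    have "dist (sum f X) (sum f {..<N}) < e" if "finite X" "{..<N} \<subseteq> X" for X
      unfolding dist_nonarch_norm sum_diff[OF that, symmetric]
      by (rule nonarch_norm_sum_less) (use \<open>e > 0\<close> N in auto)
    then show ?thesis by blast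
  qed
  have "Cauchy (\<lambda>n. sum f {..<n})"
    unfolding Cauchy_altdef2
  proof (intro allI impI)
    fix e :: real assume "e > 0"
    then obtain N where "\<forall>X. finite X \<longrightarrow> {..<N} \<subseteq> X \<longrightarrow> dist (sum f X) (sum f {..<N}) < e"
      using tail by blast
    then show "\<exists>N. \<forall>n\<ge>N. dist (sum f {..<n}) (sum f {..<N}) < e"
      by (intro exI[of _ N]) simp
  qed
  then obtain s where s: "(\<lambda>n. sum f {..<n}) \<longlonglongrightarrow> s"
    by (auto simp: Cauchy_convergent_iff convergent_def)
  have "(f has_sum s) UNIV"
    unfolding has_sum_def tendsto_iff eventually_finite_subsets_at_top
  proof (intro allI impI)
    fix e :: real assume "e > 0"
    then obtain N where N: "\<And>X. finite X \<Longrightarrow> {..<N} \<subseteq> X \<Longrightarrow> dist (sum f X) (sum f {..<N}) < e/3"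
      using tail[of "e/3"] by auto
    obtain M where M: "\<And>n. n \<ge> M \<Longrightarrow> dist (sum f {..<n}) s < e/3"
      using metric_LIMSEQ_D[OF s, of "e/3"] \<open>e > 0\<close> by auto
    \<comment> \<open>The segment \<open>{..<max M N}\<close> links the two estimates: it contains
      \<open>{..<N}\<close>, and its sum is already close to \<open>s\<close>. Three distances are
      added, hence \<open>e/3\<close>.\<close>
    have "dist (sum f X) s < e" if "finite X" "{..<N} \<subseteq> X" for X
      using N[OF that] N[of "{..<max M N}"] M[of "max M N"]
        dist_triangle[of "sum f X" s "sum f {..<N}"]
        dist_triangle[of "sum f {..<N}" s "sum f {..<max M N}"]
      by (simp add: dist_commute)
    then show "\<exists>X. finite X \<and> X \<subseteq> UNIV \<and>
        (\<forall>Y. finite Y \<and> X \<subseteq> Y \<and> Y \<subseteq> UNIV \<longrightarrow> dist (sum f Y) s < e)"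
      by (intro exI[of _ "{..<N}"]) auto
  qed
  then show thesis by (rule that)
qed

text \<open>A monomial in one umbra is determined by its exponent; together with
  \<open>inj_single\<close> this turns sums over monomials into sums over
  \<open>nat\<close>.\<close>

lemma monomials_singleton: "monomials {\<gamma>} = range (Poly_Mapping.single \<gamma>)"
proof -
  have "m = Poly_Mapping.single \<gamma> (Poly_Mapping.lookup m \<gamma>)"
    if "Poly_Mapping.keys m \<subseteq> {\<gamma>}" for m :: "'a \<Rightarrow>\<^sub>0 nat"
    using that by (intro poly_mapping_eqI) (auto simp: lookup_single when_def in_keys_iff)
  then show ?thesis
    by (auto simp: monomials_def split: if_splits)
qed

lemma inj_single: "inj (Poly_Mapping.single \<gamma> :: nat \<Rightarrow> _)"
  by (metis injI lookup_single_eq)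

text \<open>Only \<open>m = k - n\<close> contributes to \<open>T^n\<close>. The test
  \<open>n \<le> k\<close> is essential, since for \<open>n > k\<close> truncated subtraction would
  select \<open>m = 0\<close>.\<close>

lemma shift_expansion_nth:
  "fps_nth (\<Sum>m=0..k. of_nat (k choose m) * fps_const (c m) * fps_X ^ (k - m) :: 'a::field fps) n =
     (if n \<le> k then of_nat (k choose (k - n)) * c (k - n) else 0)"
proof -
  have "fps_nth (of_nat (k choose m) * fps_const (c m) * fps_X ^ (k - m) :: 'a fps) n =
      (if m = k - n then if n \<le> k then of_nat (k choose (k - n)) * c (k - n) else 0 else 0)"
    if "m \<in> {0..k}" for m
    using that by (auto simp: fps_X_power_nth fps_mult_right_const_nth simp flip: fps_of_nat)
  then show ?thesis
    by (simp add: fps_sum_nth)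
qed

theorem theorem3p3:
  fixes eval :: "('u, 'a::complete_nonarch_field) umbral_poly \<Rightarrow> 'a fps"
    and \<F> :: "'a \<Rightarrow> 'u" and x :: 'a and P :: "'a fps"
  assumes "umbral_calculus eval"
    and "x \<in> null_points eval \<F>"
    and "P \<in> bounded_fps"
  shows "let expansion = (\<lambda>k. fps_const (fps_nth P k) *
      (\<Sum>m=0..k. of_nat (k choose m) * fps_const (moment eval (\<F> x) m) * fps_X ^ (k - m)))
    in coeffwise_summable (flow_term eval \<F> x P)
      \<and> admissible eval {\<F> x} (umbral_shift P (\<F> x))
      \<and> coeffwise_summable expansion
      \<and> flow eval \<F> x P = eval_series eval {\<F> x} (umbral_shift P (\<F> x))
      \<and> eval_series eval {\<F> x} (umbral_shift P (\<F> x)) = coeffwise_suminf expansion"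
proof -
  define \<mu> where "\<mu> = moment eval (\<F> x)"
  define expansion where "expansion = (\<lambda>k. fps_const (fps_nth P k) *
      (\<Sum>m=0..k. of_nat (k choose m) * fps_const (\<mu> m) * fps_X ^ (k - m)))"
  \<comment> \<open>This is the coefficient of \<open>T^n\<close> in the \<open>m\<close>-th flow
    term. It is also what the monomial of exponent \<open>m\<close> contributes to
    \<open>eval_series\<close>, and what the summand \<open>k = n + m\<close> contributes to the
    expansion.\<close>
  define t where "t n m = of_nat ((n + m) choose m) * fps_nth P (n + m) * \<mu> m" for n m
  obtain c where c: "c > 0" "\<And>m. nonarch_norm (fps_nth P m) < c"
    using assms(3) by (auto simp: bounded_fps_def)
  have "t n \<longlonglongrightarrow> 0" for n
  proof -
    have "\<mu> \<longlonglongrightarrow> 0"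
      using assms(2) by (simp add: null_points_def \<mu>_def)
    then have lim: "(\<lambda>m. c * nonarch_norm (\<mu> m)) \<longlonglongrightarrow> 0"
      unfolding tendsto_zero_nonarch_iff[of \<mu>] by (rule tendsto_mult_right_zero)
    have "nonarch_norm (t n m) \<le> c * nonarch_norm (\<mu> m)" for m
    proof -
      have "nonarch_norm (of_nat ((n + m) choose m) :: 'a) * nonarch_norm (fps_nth P (n + m)) \<le> 1 * c"
        using c by (intro mult_mono nonarch_norm_of_nat nonarch_norm_nonneg less_imp_le) auto
      then show ?thesis
        by (simp add: t_def nonarch_norm_mult mult_right_mono nonarch_norm_nonneg)
    qed
    then show ?thesis
      unfolding tendsto_zero_nonarch_iff[of "t n"]
      by (intro tendsto_sandwich[OF _ _ tendsto_const lim]) (auto simp: nonarch_norm_nonneg)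
  qed
  then have "\<exists>s. (t n has_sum s) UNIV" for n
    by (blast elim: has_sum_nonarch)
  then obtain s where s: "\<And>n. (t n has_sum s n) UNIV"
    by metis
  have flow_sums: "(\<lambda>k. fps_nth (flow_term eval \<F> x P k) n) sums s n" for n
  proof -
    have "(\<lambda>k. fps_nth (flow_term eval \<F> x P k) n) = t n"
      by (auto simp: flow_term_def hasse_deriv_def t_def \<mu>_def)
    then show ?thesis
      using has_sum_imp_sums[OF s] by simp
  qed
  have eval_sum: "(eval_term eval {\<F> x} (umbral_shift P (\<F> x)) n has_sum s n) (monomials {\<F> x})" for n
  proof -
    \<comment> \<open>The unordered sum over monomials is pulled back along the injection sending an
      exponent to its monomial.\<close>
    have "eval_term eval {\<F> x} (umbral_shift P (\<F> x)) n \<circ> Poly_Mapping.single (\<F> x) = t n"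
      by (auto simp: eval_term_def umbral_shift_nth t_def \<mu>_def)
    then show ?thesis
      unfolding monomials_singleton has_sum_reindex[OF inj_single] using s by simp
  qed
  have expansion_sums: "(\<lambda>k. fps_nth (expansion k) n) sums s n" for n
  proof -
    have nth: "fps_nth (expansion k) n = (if n \<le> k then t n (k - n) else 0)" for k
      by (simp add: expansion_def shift_expansion_nth t_def)
    \<comment> \<open>Substituting \<open>k = n + m\<close> sums over \<open>k \<ge> n\<close> only;
      the remaining \<open>k < n\<close> contribute 0, so the sum extends to all of
      \<open>nat\<close>.\<close>
    have "(\<lambda>k. fps_nth (expansion k) n) \<circ> (\<lambda>m. n + m) = t n"
      by (auto simp: nth)
    then have "((\<lambda>k. fps_nth (expansion k) n) has_sum s n) (range (\<lambda>m. n + m))"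
      using s by (subst has_sum_reindex) auto
    also have "?this \<longleftrightarrow> ((\<lambda>k. fps_nth (expansion k) n) has_sum s n) UNIV"
      by (rule has_sum_cong_neutral) (auto simp: nth image_iff le_iff_add)
    finally show ?thesis
      by (rule has_sum_imp_sums)
  qed
  have "coeffwise_summable (flow_term eval \<F> x P)"
    and "flow eval \<F> x P = Abs_fps s"
    using flow_sums by (auto simp: coeffwise_summable_def flow_def coeffwise_suminf_def sums_iff)
  moreover have "admissible eval {\<F> x} (umbral_shift P (\<F> x))"
    using eval_sum by (auto simp: admissible_def umbral_shift_in summable_on_def)
  moreover have "eval_series eval {\<F> x} (umbral_shift P (\<F> x)) = Abs_fps s"
    by (simp add: eval_series_def infsumI[OF eval_sum])
  moreover have "coeffwise_summable expansion" and "coeffwise_suminf expansion = Abs_fps s"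
    using expansion_sums by (auto simp: coeffwise_summable_def coeffwise_suminf_def sums_iff)
  ultimately show ?thesis
    by (simp add: Let_def expansion_def \<mu>_def)
qed

end
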